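(* Let $\mathbb{F}_q$ be a finite field and let $G$ be a noncyclic subgroup of $\mathrm{PGL}_2(\mathbb{F}_q)$. Then any $G$-invariant polynomial has degree two; that is, if $f\in\mathbb{F}_q[x]$ is a monic irreducible polynomial of degree $k\ge 2$ with $[B]\circ f=f$ for every $[B]\in G$, then $k=2$.
   Context: $\mathbb{F}_q$ is the finite field with $q$ elements, $q$ a power of a prime $p$. For $A=\begin{pmatrix}a&b\\c&d\end{pmatrix}\in\mathrm{GL}_2(\mathbb{F}_q)$ and $f\in\mathbb{F}_q[x]$ of degree $k$, set $A\circ f=(bx+d)^k f\left(\frac{ax+c}{bx+d}\right)$. If $[A]$ denotes the class of $A$ in $\mathrm{PGL}_2(\mathbb{F}_q)$ and $f$ is a nonzero polynomial, set $[A]\circ f=c_{f,A}\cdot(A\circ f)$, where $c_{f,A}\in\mathbb{F}_q^*$ is the element making $c_{f,A}\cdot(A\circ f)$ monic. This defines an action of $\mathrm{PGL}_2(\mathbb{F}_q)$ on the set of monic irreducible polynomials of degree $k$ over $\mathbb{F}_q$, for each $k\ge 2$. A monic irreducible polynomial $f$ of degree $k\geq 2$ is $G$-invariant, for a subgroup $G$ of $\mathrm{PGL}_2(\mathbb{F}_q)$, if $[B]\circ f=f$ for any $[B]\in G$. *)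

theory Defs
  imports
    "HOL-Analysis.Determinants"
    "HOL-Algebra.Elementary_Groups"
    "HOL-Computational_Algebra.Polynomial_Factorial"
begin

section \<open>The groups \<open>GL\<^sub>2(K)\<close> and \<open>PGL\<^sub>2(K)\<close>\<close>

definition GL2 :: "('a::field ^ 2 ^ 2) monoid" where
  "GL2 = \<lparr>carrier = {A. invertible A}, mult = (**), one = mat 1\<rparr>"

definition scalars2 :: "('a::field ^ 2 ^ 2) set" where
  "scalars2 = {mat c | c. c \<noteq> 0}"

definition PGL2 :: "('a::field ^ 2 ^ 2) set monoid" where
  "PGL2 = GL2 Mod scalars2"

definition pgl2_class :: "'a::field ^ 2 ^ 2 \<Rightarrow> ('a ^ 2 ^ 2) set" where
  "pgl2_class A = scalars2 #>\<^bsub>GL2\<^esub> A"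

lemma group_GL2: "group (GL2 :: ('a::field ^ 2 ^ 2) monoid)"
proof (rule groupI)
  fix A :: "'a ^ 2 ^ 2"
  assume "A \<in> carrier GL2"
  then obtain B where "A ** B = mat 1" "B ** A = mat 1"
    by (auto simp: GL2_def invertible_def)
  then show "\<exists>B\<in>carrier GL2. B \<otimes>\<^bsub>GL2\<^esub> A = \<one>\<^bsub>GL2\<^esub>"
    by (auto simp: GL2_def invertible_def)
next
  show "\<one>\<^bsub>GL2\<^esub> \<in> carrier (GL2 :: ('a ^ 2 ^ 2) monoid)"
    by (auto simp: GL2_def invertible_def intro!: exI[of _ "mat 1"])
qed (auto simp: GL2_def invertible_mult matrix_mul_assoc)

lemma mat_mult_left_nth: "(mat c ** A) $ i $ j = c * (A :: 'a::field ^ 2 ^ 2) $ i $ j"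
  by (simp add: matrix_matrix_mult_def mat_def if_distrib if_distribR cong: if_cong)

lemma mat_mult_right_nth: "((A :: 'a::field ^ 2 ^ 2) ** mat c) $ i $ j = A $ i $ j * c"
  by (simp add: matrix_matrix_mult_def mat_def if_distrib if_distribR cong: if_cong)

lemma mat_mult_commute: "mat c ** A = (A :: 'a::field ^ 2 ^ 2) ** mat c"
  by (simp add: vec_eq_iff mat_mult_left_nth mat_mult_right_nth mult.commute)

lemma mat_mult_mat: "mat c ** mat d = (mat (c * d) :: 'a::field ^ 2 ^ 2)"
  unfolding vec_eq_iff mat_mult_left_nth by (auto simp: mat_def)

lemma invertible_mat: "c \<noteq> 0 \<Longrightarrow> invertible (mat c :: 'a::field ^ 2 ^ 2)"
  by (auto simp: invertible_def mat_mult_mat intro!: exI[of _ "mat (inverse c)"])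

lemma normal_scalars2: "scalars2 \<lhd> (GL2 :: ('a::field ^ 2 ^ 2) monoid)"
proof -
  interpret group "GL2 :: ('a ^ 2 ^ 2) monoid" by (rule group_GL2)
  have "subgroup scalars2 (GL2 :: ('a ^ 2 ^ 2) monoid)"
  proof (rule subgroupI)
    show "scalars2 \<subseteq> carrier (GL2 :: ('a ^ 2 ^ 2) monoid)"
      by (auto simp: scalars2_def GL2_def invertible_mat)
    show "scalars2 \<noteq> ({} :: ('a ^ 2 ^ 2) set)"
      by (auto simp: scalars2_def intro!: exI[of _ 1])
  next
    fix A :: "'a ^ 2 ^ 2"
    assume "A \<in> scalars2"
    then obtain c where c: "A = mat c" "c \<noteq> 0" by (auto simp: scalars2_def)
    have "inv\<^bsub>GL2\<^esub> A = mat (inverse c)"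
      by (rule inv_equality) (use c in \<open>auto simp: GL2_def mat_mult_mat invertible_mat\<close>)
    with c show "inv\<^bsub>GL2\<^esub> A \<in> scalars2" by (auto simp: scalars2_def)
  next
    fix A B :: "'a ^ 2 ^ 2"
    assume "A \<in> scalars2" "B \<in> scalars2"
    then show "A \<otimes>\<^bsub>GL2\<^esub> B \<in> scalars2"
      by (auto simp: scalars2_def GL2_def mat_mult_mat)
  qed
  then show ?thesis
    by (rule normalI)
       (auto simp: r_coset_def l_coset_def GL2_def scalars2_def mat_mult_commute)
qed

lemma group_PGL2: "group (PGL2 :: ('a::field ^ 2 ^ 2) set monoid)"
  unfolding PGL2_def by (rule normal.factorgroup_is_group[OF normal_scalars2])

lemma carrier_PGL2: "carrier PGL2 = pgl2_class ` {A. invertible A}"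
  by (auto simp: PGL2_def FactGroup_def RCOSETS_def pgl2_class_def GL2_def)


section \<open>The action on polynomials\<close>

text \<open>For \<open>A = (a b; c d)\<close> and \<open>k = degree f\<close> this is
  \<open>(b x + d)\<^sup>k f ((a x + c) / (b x + d))\<close> with denominators cleared; see \<open>gl2_act_fract\<close>.\<close>

definition gl2_act :: "'a::field ^ 2 ^ 2 \<Rightarrow> 'a poly \<Rightarrow> 'a poly" where
  "gl2_act A f =
     (\<Sum>i\<le>degree f. smult (coeff f i)
        ([:A $ 2 $ 1, A $ 1 $ 1:] ^ i * [:A $ 2 $ 2, A $ 1 $ 2:] ^ (degree f - i)))"

definition monic_multiple :: "'a::field poly \<Rightarrow> 'a poly" where
  "monic_multiple g = smult (inverse (lead_coeff g)) g"

text \<open>The choice of the representative is irrelevant; see \<open>pgl2_act_class\<close>.\<close>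

definition pgl2_act :: "('a::field ^ 2 ^ 2) set \<Rightarrow> 'a poly \<Rightarrow> 'a poly" where
  "pgl2_act C f = monic_multiple (gl2_act (SOME A. A \<in> C) f)"

definition pgl2_invariant :: "('a::field ^ 2 ^ 2) set set \<Rightarrow> 'a poly \<Rightarrow> bool" where
  "pgl2_invariant G f \<longleftrightarrow> (\<forall>C\<in>G. pgl2_act C f = f)"

lemma gl2_act_fract:
  fixes A :: "'a::field ^ 2 ^ 2"
  assumes "invertible A"
  shows "to_fract (gl2_act A f) =
    to_fract [:A $ 2 $ 2, A $ 1 $ 2:] ^ degree f *
    poly (map_poly (\<lambda>c. to_fract [:c:]) f)
      (to_fract [:A $ 2 $ 1, A $ 1 $ 1:] / to_fract [:A $ 2 $ 2, A $ 1 $ 2:])"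
proof -
  define p where "p = to_fract [:A $ 2 $ 1, A $ 1 $ 1:]"
  define r where "r = to_fract [:A $ 2 $ 2, A $ 1 $ 2:]"
  have r: "r \<noteq> 0"
    using assms by (auto simp: r_def invertible_det_nz det_2)
  have power: "to_fract (g ^ n) = to_fract g ^ n" for g :: "'a poly" and n
    by (induction n) auto
  have sum: "to_fract (\<Sum>i\<in>I. h i) = (\<Sum>i\<in>I. to_fract (h i))"
    if "finite I" for h :: "nat \<Rightarrow> 'a poly" and I
    using that by induction auto
  have smult: "to_fract (smult c g) = to_fract [:c:] * to_fract g" for c and g :: "'a poly"
    by (simp flip: to_fract_mult)
  have degree: "degree (map_poly (\<lambda>c. to_fract [:c:]) f) = degree f"
    by (rule degree_map_poly) auto
  have "to_fract (gl2_act A f) =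
      (\<Sum>i\<le>degree f. to_fract [:coeff f i:] * (p ^ i * r ^ (degree f - i)))"
    by (simp add: gl2_act_def sum smult power p_def r_def)
  also have "\<dots> = (\<Sum>i\<le>degree f. r ^ degree f * (to_fract [:coeff f i:] * (p / r) ^ i))"
    by (rule sum.cong) (use r in \<open>auto simp: power_diff power_divide\<close>)
  also have "\<dots> = r ^ degree f * poly (map_poly (\<lambda>c. to_fract [:c:]) f) (p / r)"
    by (simp add: poly_altdef degree coeff_map_poly sum_distrib_left)
  finally show ?thesis by (simp add: p_def r_def)
qed

lemma gl2_act_scalar:
  fixes A :: "'a::field ^ 2 ^ 2"
  shows "gl2_act (mat c ** A) f = smult (c ^ degree f) (gl2_act A f)"
proof -
  have eq: "[:c * u, c * v:] = smult c [:u, v:]" for u v by simp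
  have sum_smult: "smult d (\<Sum>i\<in>I. h i) = (\<Sum>i\<in>I. smult d (h i))"
    if "finite I" for d and h :: "nat \<Rightarrow> 'a poly" and I
    using that by induction (auto simp: smult_add_right)
  have "gl2_act (mat c ** A) f = (\<Sum>i\<le>degree f. smult (coeff f i)
     (smult (c ^ i * c ^ (degree f - i))
        ([:A $ 2 $ 1, A $ 1 $ 1:] ^ i * [:A $ 2 $ 2, A $ 1 $ 2:] ^ (degree f - i))))"
    unfolding gl2_act_def mat_mult_left_nth eq
    by (simp add: smult_power ac_simps del: smult_pCons)
  also have "\<dots> = smult (c ^ degree f) (gl2_act A f)"
    unfolding gl2_act_def sum_smult[OF finite_atMost]
    by (rule sum.cong) (auto simp: mult.commute simp flip: power_add)
  finally show ?thesis .
qed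

lemma pgl2_act_class:
  fixes A :: "'a::field ^ 2 ^ 2"
  shows "pgl2_act (pgl2_class A) f = monic_multiple (gl2_act A f)"
proof -
  have class_eq: "pgl2_class A = {mat c ** A | c. c \<noteq> 0}"
    by (auto simp: pgl2_class_def r_coset_def scalars2_def GL2_def)
  have "mat 1 ** A \<in> pgl2_class A"
    unfolding class_eq by (rule CollectI, rule exI[of _ 1]) auto
  then have "(SOME B. B \<in> pgl2_class A) \<in> pgl2_class A"
    by (rule someI)
  then obtain c where c: "(SOME B. B \<in> pgl2_class A) = mat c ** A" "c \<noteq> 0"
    unfolding class_eq by blast
  then show ?thesis
    by (simp add: pgl2_act_def gl2_act_scalar monic_multiple_def field_simps)
qed

end

theory Submission
  imports "HOL-Algebra.Algebraic_Closure_Type" Defs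
begin

no_notation fps_nth (infixl \<open>$\<close> 75)

text \<open>Let \<open>x\<close> be a root of \<open>f\<close> in an algebraic closure of \<open>F\<^sub>q\<close>. If \<open>[A]\<close> fixes \<open>f\<close>, then the
  Moebius transformation of \<open>A\<close> maps \<open>x\<close> to another root of \<open>f\<close>, which is \<open>x\<close> raised to
  the power \<open>q\<^sup>i\<close> for some \<open>i\<close>. Moebius transformations over \<open>F\<^sub>q\<close> commute with Frobenius, so
  these exponents add up under multiplication in \<open>G\<close>. If \<open>degree f > 2\<close>, then \<open>i\<close> determines
  \<open>[A]\<close>, because two Moebius transformations that agree at \<open>x\<close> give a polynomial of degree at
  most two vanishing at \<open>x\<close>. So \<open>G\<close> is embedded in a cyclic group.\<close>


section \<open>A cyclicity criterion\<close>

text \<open>The quotients \<open>y z\<^sup>-\<^sup>1\<close> with \<open>R y i\<close> and \<open>R z j\<close> depend only on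
  \<open>i - j\<close>, so the group is the image of a subgroup of the integers.\<close>

lemma (in group) cyclic_group_additive_labelling:
  fixes R :: "'a \<Rightarrow> nat \<Rightarrow> bool"
  assumes total: "\<And>x. x \<in> carrier G \<Longrightarrow> \<exists>i. R x i"
    and mult: "\<And>x y i j. \<lbrakk>x \<in> carrier G; y \<in> carrier G; R x i; R y j\<rbrakk> \<Longrightarrow> R (x \<otimes> y) (i + j)"
    and inj: "\<And>x y i. \<lbrakk>x \<in> carrier G; y \<in> carrier G; R x i; R y i\<rbrakk> \<Longrightarrow> x = y"
  shows "cyclic_group G"
proof -
  have comm: "x \<otimes> y = y \<otimes> x" if "x \<in> carrier G" "y \<in> carrier G" for x y
  proof -
    from total that obtain i j where "R x i" "R y j" by meson
    with mult[of x y i j] mult[of y x j i] inj[of "x \<otimes> y" "y \<otimes> x" "i + j"] that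
    show ?thesis by (simp add: add.commute)
  qed
  \<comment> \<open>\<open>D n\<close> says that two labels of group elements differ by
    \<open>n > 0\<close>. With the least such \<open>d\<close>, the quotient \<open>g\<close> of two
    elements whose labels differ by \<open>d\<close> will generate the group.\<close>
  define D where "D n \<longleftrightarrow> n > 0 \<and>
    (\<exists>y\<in>carrier G. \<exists>z\<in>carrier G. \<exists>j. R y (j + n) \<and> R z j)" for n
  obtain e where e: "R \<one> e" using total by blast
  have "\<exists>g\<in>carrier G. \<forall>x\<in>carrier G. \<exists>n::int. x = g [^] n"
  proof (cases "\<exists>n. D n")
    case False
    \<comment> \<open>Without positive differences every label equals \<open>e\<close>, a label of
      the identity.\<close>
    have "x = \<one>" if x: "x \<in> carrier G" for x
    proof -
      obtain i where i: "R x i" using total x by blast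
      have "\<not> i < e" using False e i x unfolding D_def
        by (metis one_closed less_imp_add_positive)
      moreover have "\<not> e < i" using False e i x unfolding D_def
        by (metis one_closed less_imp_add_positive)
      ultimately show ?thesis using inj[OF x one_closed i] e by simp
    qed
    then show ?thesis by (intro bexI[of _ \<one>]) (auto intro: exI[of _ 0])
  next
    case True
    define d where "d = (LEAST n. D n)"
    have "D d" using True unfolding d_def by (rule LeastI_ex)
    then obtain y z j where d: "d > 0" and yz: "y \<in> carrier G" "z \<in> carrier G"
      and R: "R y (j + d)" "R z j" unfolding D_def by blast
    have minimal: "\<not> D n" if "n < d" for n
      using that not_less_Least unfolding d_def by blast
    define g where "g = y \<otimes> inv z"
    have g: "g \<in> carrier G" by (simp add: g_def yz)
    have gz: "y = g \<otimes> z" by (simp add: g_def yz m_assoc)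
    have quotient: "\<exists>m::nat. x = g [^] m \<otimes> w"
      if "x \<in> carrier G" "w \<in> carrier G" "R x (l + n)" "R w l" for x w l n
      using that
    proof (induction n arbitrary: x w l rule: less_induct)
      case (less n)
      consider "n = 0" | "0 < n" "n < d" | "d \<le> n" by linarith
      then show ?case
      proof cases
        case 1
        then have "x = w" using inj less.prems by simp
        then show ?thesis using less.prems by (intro exI[of _ 0]) auto
      next
        case 2
        then have "D n" unfolding D_def using less.prems by blast
        then show ?thesis using minimal 2 by blast
      next
        case 3
        \<comment> \<open>Inverses come with no known labels, so instead of dividing by
          \<open>g\<close> both sides are multiplied, \<open>x\<close> by \<open>z\<close> and
          \<open>w\<close> by \<open>y\<close>. This lowers the difference of labels from
          \<open>n\<close> to \<open>n - d\<close>.\<close>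
        have "R (x \<otimes> z) (l + n + j)" "R (w \<otimes> y) (l + (j + d))"
          using mult less.prems yz R by blast+
        moreover have "l + n + j = l + (j + d) + (n - d)" using 3 by simp
        ultimately obtain m :: nat where m: "x \<otimes> z = g [^] m \<otimes> (w \<otimes> y)"
          using less.IH[of "n - d" "x \<otimes> z" "w \<otimes> y" "l + (j + d)"] 3 d less.prems yz by auto
        also have "\<dots> = g [^] m \<otimes> (g \<otimes> w \<otimes> z)"
          using gz comm[of w g] g less.prems yz by (simp flip: m_assoc)
        also have "\<dots> = (g [^] Suc m \<otimes> w) \<otimes> z"
          using g less.prems yz by (simp add: m_assoc)
        finally have "x = g [^] Suc m \<otimes> w"
          using less.prems yz g by (simp del: nat_pow_Suc)
        then show ?thesis by blast
      qed
    qed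
    have "\<exists>n::int. x = g [^] n" if x: "x \<in> carrier G" for x
    proof -
      obtain i where i: "R x i" using total x by blast
      show ?thesis
      proof (cases "e \<le> i")
        case True
        then obtain m :: nat where "x = g [^] m"
          using quotient[of x \<one> e "i - e"] x i e g by auto
        then show ?thesis by (intro exI[of _ "int m"]) (simp add: int_pow_int)
      next
        case False
        \<comment> \<open>The label of \<open>x\<close> is below that of the identity, so their
          roles are exchanged and \<open>x\<close> is the inverse of a power of
          \<open>g\<close>.\<close>
        then obtain m :: nat where "\<one> = g [^] m \<otimes> x"
          using quotient[of \<one> x i "e - i"] x i e by auto
        then have "x = inv (g [^] m)" using x g
          by (metis inv_equality inv_inv nat_pow_closed)
        then show ?thesis using g by (intro exI[of _ "- int m"]) (simp add: int_pow_neg_int)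
      qed
    qed
    then show ?thesis using g by blast
  qed
  then show ?thesis unfolding cyclic_group by (force simp: int_pow_closed)
qed


section \<open>The Frobenius map on the algebraic closure of a finite field\<close>

text \<open>The library has this only for the type class \<open>finite_field\<close>, which the sort
  \<open>{field, finite}\<close> does not imply.\<close>

lemma finite_field_power_card:
  fixes x :: "'a::{field,finite}"
  shows "x ^ CARD('a) = x"
proof (cases "x = 0")
  case False
  have "(\<Prod>y\<in>UNIV-{0}. y) = (\<Prod>y\<in>UNIV-{0}. x * y)"
    by (rule prod.reindex_bij_witness[of _ "\<lambda>y. x * y" "\<lambda>y. y / x"]) (use False in auto)
  also have "\<dots> = x ^ (CARD('a) - 1) * (\<Prod>y\<in>UNIV-{0}. y)"
    by (simp add: prod.distrib card_Diff_singleton)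
  finally have "x ^ (CARD('a) - 1) = 1" by simp
  then show ?thesis using power_minus_mult[of "CARD('a)" x] by simp
qed simp

lemma card_range_to_ac: "card (range (to_ac :: 'a::{field,finite} \<Rightarrow> _)) = CARD('a)"
  by (simp add: card_image inj_to_ac)

lemma to_ac_power_card [simp]: "to_ac (c :: 'a::{field,finite}) ^ CARD('a) = to_ac c"
  by (simp add: finite_field_power_card flip: to_ac_power)

text \<open>Both sides are polynomials in \<open>x\<close> with the same leading term of degree \<open>q\<close>, so it
  suffices to compare them at the \<open>q\<close> elements of the ground field. There the roles of \<open>x\<close>
  and \<open>y\<close> can be exchanged, and the same argument applies once more. This avoids showing
  that \<open>q\<close> is a prime power.\<close>

lemma frobenius_add:
  fixes x y :: "'a::{field,finite} alg_closure"
  shows "(x + y) ^ CARD('a) = x ^ CARD('a) + y ^ CARD('a)"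
proof -
  let ?q = "CARD('a)"
  have extend: "(u + v) ^ ?q = u ^ ?q + v ^ ?q"
    if "\<And>c. (to_ac c + v) ^ ?q = to_ac c ^ ?q + v ^ ?q" for u v :: "'a alg_closure"
  proof -
    have "[:v, 1:] ^ ?q = monom 1 ?q + [:v ^ ?q:]"
    proof (rule poly_eqI_degree_lead_coeff[where A = "range to_ac" and n = "?q"])
      show "coeff ([:v, 1:] ^ ?q) ?q = coeff (monom 1 ?q + [:v ^ ?q:]) ?q"
        by (simp add: coeff_linear_power coeff_pCons split: nat.split)
      show "degree ([:v, 1:] ^ ?q) \<le> ?q"
        by (simp add: degree_linear_power)
      show "degree (monom 1 ?q + [:v ^ ?q:]) \<le> ?q"
        by (intro degree_add_le degree_monom_le) simp
    qed (use that in \<open>auto simp: card_range_to_ac poly_monom add.commute\<close>)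
    from arg_cong[OF this, of "\<lambda>p. poly p u"] show ?thesis
      by (simp add: poly_monom add.commute)
  qed
  have "(to_ac c + v) ^ ?q = to_ac c ^ ?q + v ^ ?q" for c and v :: "'a alg_closure"
    using extend[of "to_ac c" v] extend[of v "to_ac c"]
    by (simp add: add.commute flip: to_ac_add)
  then show ?thesis by (rule extend)
qed

lemma frobenius_minus:
  fixes x :: "'a::{field,finite} alg_closure"
  shows "(- x) ^ CARD('a) = - (x ^ CARD('a))"
  using frobenius_add[of x "- x"] by (simp add: power_0_left eq_neg_iff_add_eq_0 add.commute)

text \<open>By additivity the difference of the two powers is the power of
  \<open>x - y\<close>.\<close>

lemma frobenius_eq_iff:
  fixes x y :: "'a::{field,finite} alg_closure"
  shows "x ^ CARD('a) = y ^ CARD('a) \<longleftrightarrow> x = y"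
  using frobenius_add[of "x - y" y] by auto

lemma frobenius_power_add:
  fixes x y :: "'a::{field,finite} alg_closure"
  shows "(x + y) ^ (CARD('a) ^ i) = x ^ (CARD('a) ^ i) + y ^ (CARD('a) ^ i)"
  by (induction i) (simp_all add: power_mult frobenius_add mult.commute[of "CARD('a)"])

lemma to_ac_frobenius_power [simp]:
  "to_ac (c :: 'a::{field,finite}) ^ (CARD('a) ^ i) = to_ac c"
  by (induction i) (simp_all add: power_mult mult.commute[of "CARD('a)"])

text \<open>The polynomial \<open>X^q - X\<close> has at most \<open>q\<close> roots, and the
  \<open>q\<close> elements of the ground field are already roots.\<close>

lemma frobenius_fixed_iff:
  fixes x :: "'a::{field,finite} alg_closure"
  shows "x ^ CARD('a) = x \<longleftrightarrow> x \<in> range to_ac"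
proof -
  let ?p = "monom 1 CARD('a) - [:0, 1:] :: 'a alg_closure poly"
  have "CARD('a) > 1" using card_mono[of UNIV "{0, 1 :: 'a}"] by simp
  then have coeff: "coeff ?p CARD('a) = 1"
    by (auto simp: coeff_pCons split: nat.split)
  then have nz: "?p \<noteq> 0" by (metis coeff_0 zero_neq_one)
  have "degree ?p \<le> CARD('a)"
    using \<open>CARD('a) > 1\<close> by (intro degree_diff_le degree_monom_le) simp
  then have "card {z. poly ?p z = 0} \<le> card (range (to_ac :: 'a \<Rightarrow> _))"
    using card_poly_roots_bound[OF nz] by (simp add: card_range_to_ac)
  moreover have "range (to_ac :: 'a \<Rightarrow> _) \<subseteq> {z. poly ?p z = 0}"
    by (auto simp: poly_monom)
  ultimately have "range (to_ac :: 'a \<Rightarrow> _) = {z. poly ?p z = 0}"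
    using poly_roots_finite[OF nz] by (intro card_seteq) auto
  then show ?thesis by (auto simp: poly_monom)
qed


section \<open>Roots in the algebraic closure\<close>

text \<open>Serves two coefficient maps: the embedding \<open>to_ac\<close> and the Frobenius
  power.\<close>

lemma map_poly_mult_hom:
  fixes h :: "'a::comm_ring_1 \<Rightarrow> 'b::comm_ring_1"
  assumes "h 0 = 0" "\<And>x y. h (x + y) = h x + h y" "\<And>x y. h (x * y) = h x * h y"
  shows "map_poly h (p * q) = map_poly h p * map_poly h q"
proof -
  have "h (\<Sum>i\<in>I. g i) = (\<Sum>i\<in>I. h (g i))" if "finite I" for g :: "nat \<Rightarrow> 'a" and I
    using that by induction (simp_all add: assms)
  then show ?thesis by (intro poly_eqI) (simp add: coeff_map_poly coeff_mult assms)
qed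

definition ac_eval :: "'a::field poly \<Rightarrow> 'a alg_closure \<Rightarrow> 'a alg_closure" where
  "ac_eval p x = poly (map_poly to_ac p) x"

lemma ac_eval_0 [simp]: "ac_eval 0 x = 0"
  by (simp add: ac_eval_def)

lemma ac_eval_pCons [simp]: "ac_eval (pCons c p) x = to_ac c + x * ac_eval p x"
  by (simp add: ac_eval_def map_poly_pCons)

lemma ac_eval_add [simp]: "ac_eval (p + q) x = ac_eval p x + ac_eval q x"
  by (induction p q rule: poly_induct2) (simp_all add: algebra_simps)

lemma ac_eval_mult [simp]: "ac_eval (p * q) x = ac_eval p x * ac_eval q x"
  by (simp add: ac_eval_def map_poly_mult_hom)

lemma ac_eval_1 [simp]: "ac_eval 1 x = 1"
  by (simp add: ac_eval_def)

lemma ac_eval_power [simp]: "ac_eval (p ^ n) x = ac_eval p x ^ n"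
  by (induction n) simp_all

lemma ac_eval_smult [simp]: "ac_eval (smult c p) x = to_ac c * ac_eval p x"
  by (induction p) (simp_all add: algebra_simps)

lemma ac_eval_sum: "ac_eval (\<Sum>i\<in>I. g i) x = (\<Sum>i\<in>I. ac_eval (g i) x)"
  by (induction I rule: infinite_finite_induct) simp_all

lemma ac_eval_altdef:
  "ac_eval p x = (\<Sum>i\<le>degree p. to_ac (coeff p i) * x ^ i)"
proof -
  have "degree (map_poly to_ac p) = degree p"
    by (rule degree_map_poly) simp
  then show ?thesis by (simp add: ac_eval_def poly_altdef coeff_map_poly)
qed

lemma ac_eval_frobenius:
  fixes p :: "'a::{field,finite} poly"
  shows "ac_eval p (x ^ CARD('a)) = ac_eval p x ^ CARD('a)"
  by (induction p) (simp_all add: frobenius_add power_mult_distrib)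

lemma finite_ac_roots: "p \<noteq> 0 \<Longrightarrow> finite {x. ac_eval p x = 0}"
  unfolding ac_eval_def by (rule poly_roots_finite) (simp add: map_poly_eq_0_iff)

lemma ac_root_exists:
  assumes "degree p > 0"
  obtains x where "ac_eval p x = 0"
proof -
  have "degree (map_poly to_ac p) = degree p"
    by (rule degree_map_poly) simp
  then show ?thesis
    using assms alg_closed_imp_poly_has_root[of "map_poly to_ac p"] that
    by (auto simp: ac_eval_def)
qed

text \<open>Division with remainder shows that a nonzero polynomial \<open>m\<close> of least degree
  vanishing at \<open>x\<close> divides every polynomial vanishing at \<open>x\<close>. It is not a
  unit, so the irreducible \<open>f\<close> is associated to it.\<close>

lemma irreducible_dvd_if_common_root:
  fixes f g :: "'a::field poly"
  assumes "irreducible f" "ac_eval f x = 0" "ac_eval g x = 0"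
  shows "f dvd g"
proof -
  define P where "P p \<longleftrightarrow> p \<noteq> 0 \<and> ac_eval p x = 0" for p :: "'a poly"
  define m where "m = arg_min degree P"
  have "P f" using assms by (auto simp: P_def irreducible_def)
  then have "P m" and least: "\<And>p. P p \<Longrightarrow> degree m \<le> degree p"
    unfolding m_def by (auto intro: arg_min_natI arg_min_nat_le)
  have m_dvd: "m dvd p" if "ac_eval p x = 0" for p
  proof -
    have "ac_eval p x = ac_eval (p div m * m + p mod m) x" by simp
    then have "ac_eval (p mod m) x = 0"
      using that \<open>P m\<close> unfolding ac_eval_add ac_eval_mult P_def by simp
    then have "p mod m = 0"
      using least[of "p mod m"] degree_mod_less[of m p] \<open>P m\<close> by (force simp: P_def)
    then show ?thesis by auto
  qed
  obtain k where k: "f = m * k" using m_dvd[OF assms(2)] by (auto simp: dvd_def)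
  have "\<not> m dvd 1"
  proof
    assume "m dvd 1"
    then obtain c where "m = [:c:]" by (auto simp: is_unit_poly_iff)
    then show False using \<open>P m\<close> by (simp add: P_def)
  qed
  then have "k dvd 1" using irreducibleD[OF assms(1) k] by blast
  then have "f dvd m" by (simp add: k)
  then show ?thesis using m_dvd[OF assms(3)] dvd_trans by blast
qed

text \<open>The product of the linear factors over the Frobenius orbit of a root has coefficients
  in the ground field, so it is divisible by \<open>f\<close>.\<close>

lemma roots_frobenius_orbit:
  fixes f :: "'a::{field,finite} poly"
  assumes irr: "irreducible f"
    and x: "ac_eval f x = 0" and y: "ac_eval f y = 0"
  obtains i where "y = x ^ (CARD('a) ^ i)"
proof -
  let ?q = "CARD('a)"
  define orbit where "orbit = range (\<lambda>i. x ^ (?q ^ i))"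
  have "f \<noteq> 0" using irr by auto
  have "ac_eval f (x ^ (?q ^ i)) = 0" for i
    by (induction i) (simp_all add: x power_mult ac_eval_frobenius mult.commute[of ?q])
  then have fin: "finite orbit"
    by (intro finite_subset[OF _ finite_ac_roots[OF \<open>f \<noteq> 0\<close>]]) (auto simp: orbit_def)
  have "(x ^ (?q ^ i)) ^ ?q = x ^ (?q ^ Suc i)" for i
    by (simp add: mult.commute flip: power_mult)
  \<comment> \<open>Frobenius maps the finite orbit injectively into itself, hence permutes it; this
    makes the coefficients of the product \<open>N\<close> Frobenius-fixed.\<close>
  then have "(\<lambda>r. r ^ ?q) ` orbit \<subseteq> orbit"
    unfolding orbit_def by (auto simp del: power_Suc)
  moreover have inj: "inj_on (\<lambda>r. r ^ ?q) orbit" by (simp add: inj_on_def frobenius_eq_iff)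
  ultimately have image: "(\<lambda>r. r ^ ?q) ` orbit = orbit" by (rule endo_inj_surj[OF fin])
  define N where "N = (\<Prod>r\<in>orbit. [:- r, 1:])"
  have "map_poly (\<lambda>c. c ^ ?q) (\<Prod>r\<in>I. [:- r, 1:]) = (\<Prod>r\<in>I. [:- (r ^ ?q), 1:])"
    if "finite I" for I :: "'a alg_closure set"
    using that
    by induction (simp_all add: map_poly_mult_hom frobenius_add frobenius_minus
        power_mult_distrib map_poly_pCons del: mult_pCons_left)
  then have "map_poly (\<lambda>c. c ^ ?q) N = (\<Prod>r\<in>orbit. [:- (r ^ ?q), 1:])"
    using fin by (simp add: N_def)
  also have "\<dots> = (\<Prod>r\<in>(\<lambda>r. r ^ ?q) ` orbit. [:- r, 1:])"
    by (simp add: prod.reindex[OF inj])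
  finally have "map_poly (\<lambda>c. c ^ ?q) N = N" by (simp add: image N_def)
  then have "coeff N i ^ ?q = coeff N i" for i
    by (metis coeff_map_poly power_0_left zero_less_card_finite less_numeral_extra(3))
  then have coeffs: "coeff N i \<in> range to_ac" for i by (simp add: frobenius_fixed_iff)
  define n where "n = map_poly of_ac N"
  have n: "map_poly to_ac n = N"
    by (rule poly_eqI) (use coeffs in \<open>simp add: n_def coeff_map_poly to_ac_of_ac\<close>)
  have root: "ac_eval n z = 0 \<longleftrightarrow> z \<in> orbit" for z
    using fin by (auto simp: ac_eval_def n N_def poly_prod)
  have "x \<in> orbit" by (auto simp: orbit_def intro: image_eqI[of _ _ 0])
  then have "f dvd n" using irreducible_dvd_if_common_root[OF irr x] root by blast
  then have "ac_eval n y = 0" using y by (auto simp: dvd_def)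
  then show ?thesis using root that by (auto simp: orbit_def)
qed


lemma ac_eval_nonzero_if_degree_less:
  fixes f p :: "'a::field poly"
  assumes "irreducible f" "ac_eval f x = 0"
    and "p \<noteq> 0" "degree p < degree f"
  shows "ac_eval p x \<noteq> 0"
  using irreducible_dvd_if_common_root[OF assms(1,2)] dvd_imp_degree_le assms(3,4)
  by (meson not_le)


section \<open>Invariant polynomials\<close>

lemma mult_pgl2_class:
  assumes "invertible A" "invertible (B :: 'a::field ^ 2 ^ 2)"
  shows "pgl2_class A \<otimes>\<^bsub>PGL2\<^esub> pgl2_class B = pgl2_class (A ** B)"
  using normal.rcos_sum[OF normal_scalars2, of A B] assms
  by (simp add: PGL2_def pgl2_class_def GL2_def)

lemma pgl2_class_scalar_mult:
  assumes "c \<noteq> 0"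
  shows "pgl2_class (mat c ** A) = pgl2_class (A :: 'a::field ^ 2 ^ 2)"
proof -
  have class_eq: "pgl2_class B = {mat d ** B | d. d \<noteq> 0}" for B :: "'a ^ 2 ^ 2"
    by (auto simp: pgl2_class_def r_coset_def scalars2_def GL2_def)
  have "\<exists>e. mat d ** (mat c ** A) = mat e ** A \<and> e \<noteq> 0" if "d \<noteq> 0" for d
    using assms that by (intro exI[of _ "d * c"]) (simp add: matrix_mul_assoc mat_mult_mat)
  moreover have "\<exists>e. mat d ** A = mat e ** (mat c ** A) \<and> e \<noteq> 0" if "d \<noteq> 0" for d
    using assms that by (intro exI[of _ "d / c"]) (simp add: matrix_mul_assoc mat_mult_mat)
  ultimately show ?thesis unfolding class_eq by blast
qed

text \<open>The hypotheses say that the off-diagonal entries of \<open>B adj(A)\<close> vanish and that its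
  diagonal entries agree, so \<open>B adj(A)\<close> is scalar.\<close>

lemma pgl2_class_eqI:
  fixes A B :: "'a::field ^ 2 ^ 2"
  assumes "invertible A" "invertible B"
    and 1: "A $ 1 $ 1 * B $ 1 $ 2 = B $ 1 $ 1 * A $ 1 $ 2"
    and 2: "A $ 2 $ 1 * B $ 2 $ 2 = B $ 2 $ 1 * A $ 2 $ 2"
    and 3: "A $ 1 $ 1 * B $ 2 $ 2 + A $ 2 $ 1 * B $ 1 $ 2 =
            B $ 1 $ 1 * A $ 2 $ 2 + B $ 2 $ 1 * A $ 1 $ 2"
  shows "pgl2_class A = pgl2_class B"
proof -
  \<comment> \<open>\<open>D\<close> is the determinant of \<open>A\<close> and \<open>l\<close> the
    upper left entry of \<open>B adj(A)\<close>. Multiplying \<open>B adj(A) = l\<close> by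
    \<open>A\<close> on the right gives \<open>D B = l A\<close>, which is checked
    entrywise.\<close>
  define D where "D = A $ 1 $ 1 * A $ 2 $ 2 - A $ 1 $ 2 * A $ 2 $ 1"
  define l where "l = B $ 1 $ 1 * A $ 2 $ 2 - B $ 1 $ 2 * A $ 2 $ 1"
  have D: "D \<noteq> 0" using assms(1) by (simp add: D_def invertible_det_nz det_2)
  have "D * B $ 1 $ 1 - l * A $ 1 $ 1 = A $ 2 $ 1 * (A $ 1 $ 1 * B $ 1 $ 2 - B $ 1 $ 1 * A $ 1 $ 2)"
    "D * B $ 1 $ 2 - l * A $ 1 $ 2 = A $ 2 $ 2 * (A $ 1 $ 1 * B $ 1 $ 2 - B $ 1 $ 1 * A $ 1 $ 2)"
    "D * B $ 2 $ 1 - l * A $ 2 $ 1 = A $ 1 $ 1 * (B $ 2 $ 1 * A $ 2 $ 2 - A $ 2 $ 1 * B $ 2 $ 2) +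
      A $ 2 $ 1 * (A $ 1 $ 1 * B $ 2 $ 2 + A $ 2 $ 1 * B $ 1 $ 2 -
        (B $ 1 $ 1 * A $ 2 $ 2 + B $ 2 $ 1 * A $ 1 $ 2))"
    "D * B $ 2 $ 2 - l * A $ 2 $ 2 = A $ 1 $ 2 * (B $ 2 $ 1 * A $ 2 $ 2 - A $ 2 $ 1 * B $ 2 $ 2) +
      A $ 2 $ 2 * (A $ 1 $ 1 * B $ 2 $ 2 + A $ 2 $ 1 * B $ 1 $ 2 -
        (B $ 1 $ 1 * A $ 2 $ 2 + B $ 2 $ 1 * A $ 1 $ 2))"
    unfolding D_def l_def by (simp_all only: algebra_simps)
  then have "\<forall>i j. D * B $ i $ j = l * A $ i $ j"
    unfolding forall_2 1 2 3 by simp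
  then have entries: "B $ i $ j = l / D * A $ i $ j" for i j
    using D by (simp add: field_simps)
  then have B: "B = mat (l / D) ** A" by (simp add: vec_eq_iff mat_mult_left_nth)
  have "l / D \<noteq> 0" using assms(2) entries by (auto simp: invertible_det_nz det_2)
  then show ?thesis using B pgl2_class_scalar_mult by metis
qed

text \<open>The denominator \<open>v\<close> does not vanish, so \<open>v ^ (degree f - i)\<close>
  is \<open>v ^ degree f\<close> divided by \<open>v ^ i\<close>.\<close>

lemma ac_eval_gl2_act:
  assumes "ac_eval [:A $ 2 $ 2, A $ 1 $ 2:] x \<noteq> 0"
  shows "ac_eval (gl2_act A f) x = ac_eval [:A $ 2 $ 2, A $ 1 $ 2:] x ^ degree f *
    ac_eval f (ac_eval [:A $ 2 $ 1, A $ 1 $ 1:] x / ac_eval [:A $ 2 $ 2, A $ 1 $ 2:] x)"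
proof -
  define u where "u = ac_eval [:A $ 2 $ 1, A $ 1 $ 1:] x"
  define v where "v = ac_eval [:A $ 2 $ 2, A $ 1 $ 2:] x"
  have "ac_eval (gl2_act A f) x =
      (\<Sum>i\<le>degree f. to_ac (coeff f i) * (u ^ i * v ^ (degree f - i)))"
    unfolding gl2_act_def ac_eval_sum ac_eval_smult ac_eval_mult ac_eval_power u_def v_def ..
  also have "\<dots> = (\<Sum>i\<le>degree f.
      v ^ degree f * (to_ac (coeff f i) * (u / v) ^ i))"
    by (rule sum.cong) (use assms in \<open>auto simp: v_def power_diff power_divide\<close>)
  finally show ?thesis
    by (simp only: u_def v_def ac_eval_altdef[of f] sum_distrib_left)
qed

text \<open>\<open>[A]\<close> acts on \<open>x\<close> as the \<open>i\<close>-th power of Frobenius, with denominators cleared.\<close>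

definition acts_as_frobenius ::
  "'a::{field,finite} alg_closure \<Rightarrow> ('a ^ 2 ^ 2) set \<Rightarrow> nat \<Rightarrow> bool" where
  "acts_as_frobenius x C i \<longleftrightarrow> (\<exists>A. invertible A \<and> C = pgl2_class A \<and>
     ac_eval [:A $ 2 $ 1, A $ 1 $ 1:] x =
     x ^ (CARD('a) ^ i) * ac_eval [:A $ 2 $ 2, A $ 1 $ 2:] x)"

lemma acts_as_frobenius_exists:
  fixes f :: "'a::{field,finite} poly"
  assumes irr: "irreducible f" and deg: "degree f \<ge> 2"
    and x: "ac_eval f x = 0" and C: "C \<in> carrier PGL2" and inv: "pgl2_act C f = f"
  shows "\<exists>i. acts_as_frobenius x C i"
proof -
  obtain A where A: "invertible A" "C = pgl2_class A" using C by (auto simp: carrier_PGL2)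
  define g where "g = gl2_act A f"
  have f: "f = smult (inverse (lead_coeff g)) g"
    using inv by (simp add: A(2) pgl2_act_class monic_multiple_def g_def)
  then have "inverse (lead_coeff g) \<noteq> 0"
    using irr by (metis not_irreducible_zero smult_0_left)
  then have "ac_eval g x = 0"
    using x arg_cong[OF f, of "\<lambda>p. ac_eval p x"] by simp
  \<comment> \<open>A nonzero polynomial of degree at most one cannot vanish at \<open>x\<close>, as
    \<open>degree f \<ge> 2\<close>.\<close>
  moreover have v: "ac_eval [:A $ 2 $ 2, A $ 1 $ 2:] x \<noteq> 0"
    using A(1) deg by (intro ac_eval_nonzero_if_degree_less[OF irr x])
      (auto simp: invertible_det_nz det_2)
  ultimately have "ac_eval f
      (ac_eval [:A $ 2 $ 1, A $ 1 $ 1:] x / ac_eval [:A $ 2 $ 2, A $ 1 $ 2:] x) = 0"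
    using ac_eval_gl2_act[OF v, of f] by (simp add: g_def del: ac_eval_pCons)
  from roots_frobenius_orbit[OF irr x this] obtain i where
    "ac_eval [:A $ 2 $ 1, A $ 1 $ 1:] x / ac_eval [:A $ 2 $ 2, A $ 1 $ 2:] x =
     x ^ (CARD('a) ^ i)" by blast
  then show ?thesis
    unfolding acts_as_frobenius_def using A v by (metis nonzero_divide_eq_eq)
qed

text \<open>The row vector \<open>(x, 1)\<close> times \<open>A\<close> is \<open>l\<close> times
  \<open>(F x, 1)\<close>, where \<open>F\<close> is the \<open>i\<close>-th Frobenius power. Since
  \<open>F\<close> fixes the entries of \<open>B\<close>, multiplying by \<open>B\<close> amounts to
  applying \<open>F\<close> to \<open>(x, 1) B\<close>.\<close>

lemma acts_as_frobenius_mult: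
  fixes x :: "'a::{field,finite} alg_closure"
  assumes "acts_as_frobenius x C i" "acts_as_frobenius x D j"
  shows "acts_as_frobenius x (C \<otimes>\<^bsub>PGL2\<^esub> D) (i + j)"
proof -
  let ?F = "\<lambda>z :: 'a alg_closure. z ^ (CARD('a) ^ i)"
  obtain A where A: "invertible A" "C = pgl2_class A"
    and uA: "ac_eval [:A $ 2 $ 1, A $ 1 $ 1:] x = ?F x * ac_eval [:A $ 2 $ 2, A $ 1 $ 2:] x"
    using assms(1) unfolding acts_as_frobenius_def by blast
  obtain B where B: "invertible B" "D = pgl2_class B"
    and uB: "ac_eval [:B $ 2 $ 1, B $ 1 $ 1:] x =
      x ^ (CARD('a) ^ j) * ac_eval [:B $ 2 $ 2, B $ 1 $ 2:] x"
    using assms(2) unfolding acts_as_frobenius_def by blast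
  define l where "l = ac_eval [:A $ 2 $ 2, A $ 1 $ 2:] x"
  have entry: "ac_eval [:(A ** B) $ 2 $ k, (A ** B) $ 1 $ k:] x =
      l * ac_eval [:B $ 2 $ k, B $ 1 $ k:] (?F x)" for k
  proof -
    have "ac_eval [:(A ** B) $ 2 $ k, (A ** B) $ 1 $ k:] x =
        ac_eval [:A $ 2 $ 1, A $ 1 $ 1:] x * to_ac (B $ 1 $ k) + l * to_ac (B $ 2 $ k)"
      by (simp add: l_def matrix_matrix_mult_def sum_2 algebra_simps)
    then show ?thesis unfolding uA by (simp add: l_def algebra_simps)
  qed
  have frob: "ac_eval [:b, a:] (?F x) = ?F (ac_eval [:b, a:] x)" for a b
    by (simp add: frobenius_power_add power_mult_distrib)
  have "?F (x ^ (CARD('a) ^ j)) = x ^ (CARD('a) ^ (i + j))"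
    by (simp add: power_add mult.commute flip: power_mult)
  then have "ac_eval [:(A ** B) $ 2 $ 1, (A ** B) $ 1 $ 1:] x =
      x ^ (CARD('a) ^ (i + j)) * ac_eval [:(A ** B) $ 2 $ 2, (A ** B) $ 1 $ 2:] x"
    unfolding entry frob uB by (simp add: power_mult_distrib del: ac_eval_pCons)
  then show ?thesis
    unfolding acts_as_frobenius_def A(2) B(2) mult_pgl2_class[OF A(1) B(1)]
    using invertible_mult[OF A(1) B(1)] by blast
qed

lemma acts_as_frobenius_inj:
  fixes f :: "'a::{field,finite} poly"
  assumes irr: "irreducible f" and deg: "degree f > 2"
    and x: "ac_eval f x = 0"
    and C: "acts_as_frobenius x C i" and D: "acts_as_frobenius x D i"
  shows "C = D"
proof -
  obtain A where A: "invertible A" "C = pgl2_class A"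
    and uA: "ac_eval [:A $ 2 $ 1, A $ 1 $ 1:] x =
      x ^ (CARD('a) ^ i) * ac_eval [:A $ 2 $ 2, A $ 1 $ 2:] x"
    using C unfolding acts_as_frobenius_def by blast
  obtain B where B: "invertible B" "D = pgl2_class B"
    and uB: "ac_eval [:B $ 2 $ 1, B $ 1 $ 1:] x =
      x ^ (CARD('a) ^ i) * ac_eval [:B $ 2 $ 2, B $ 1 $ 2:] x"
    using D unfolding acts_as_frobenius_def by blast
  \<comment> \<open>Cross-multiplying \<open>uA\<close> and \<open>uB\<close> eliminates the power
    of \<open>x\<close>. The coefficients of the resulting quadratic are the differences that
    \<open>pgl2_class_eqI\<close> requires to vanish.\<close>
  define p where "p =
    [:A $ 2 $ 1 * B $ 2 $ 2 - B $ 2 $ 1 * A $ 2 $ 2,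
      A $ 1 $ 1 * B $ 2 $ 2 + A $ 2 $ 1 * B $ 1 $ 2
        - (B $ 1 $ 1 * A $ 2 $ 2 + B $ 2 $ 1 * A $ 1 $ 2),
      A $ 1 $ 1 * B $ 1 $ 2 - B $ 1 $ 1 * A $ 1 $ 2:]"
  have "ac_eval p x =
      ac_eval [:A $ 2 $ 1, A $ 1 $ 1:] x * ac_eval [:B $ 2 $ 2, B $ 1 $ 2:] x
      - ac_eval [:B $ 2 $ 1, B $ 1 $ 1:] x * ac_eval [:A $ 2 $ 2, A $ 1 $ 2:] x"
    by (simp add: p_def algebra_simps)
  also have "\<dots> = 0" unfolding uA uB by (simp add: mult_ac del: ac_eval_pCons)
  finally have "ac_eval p x = 0" .
  moreover have "degree p \<le> 2" by (simp add: p_def)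
  ultimately have "p = 0"
    using ac_eval_nonzero_if_degree_less[OF irr x, of p] deg by fastforce
  then show ?thesis
    unfolding A(2) B(2) using A(1) B(1) by (intro pgl2_class_eqI) (auto simp: p_def)
qed

theorem theorem1p3:
  fixes G :: "('a::{field,finite} ^ 2 ^ 2) set set"
    and f :: "'a poly"
  assumes "subgroup G PGL2"
    and "\<not> cyclic_group (subgroup_generated PGL2 G)"
    and "irreducible f"
    and "lead_coeff f = 1"
    and "degree f \<ge> 2"
    and "pgl2_invariant G f"
  shows "degree f = 2"
proof (rule ccontr)
  assume "degree f \<noteq> 2"
  with \<open>degree f \<ge> 2\<close> have deg: "degree f > 2" by simp
  then obtain x where x: "ac_eval f x = 0" using ac_root_exists[of f] by auto
  have carrier: "carrier (subgroup_generated PGL2 G) = G"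
    by (rule subgroup.carrier_subgroup_generated_subgroup[OF assms(1)])
  have "cyclic_group (subgroup_generated PGL2 G)"
  \<comment> \<open>The labels are Frobenius exponents at \<open>x\<close>. A class carries many of
    them because the orbit of \<open>x\<close> is finite, so the labelling is a relation.\<close>
  proof (rule group.cyclic_group_additive_labelling)
    show "group (subgroup_generated PGL2 G)"
      by (rule group.group_subgroup_generated[OF group_PGL2])
  next
    fix C assume "C \<in> carrier (subgroup_generated PGL2 G)"
    then show "\<exists>i. acts_as_frobenius x C i"
      using assms x subgroup.subset[OF assms(1)]
      by (intro acts_as_frobenius_exists) (auto simp: carrier pgl2_invariant_def)
  next
    fix C D i j assume "acts_as_frobenius x C i" "acts_as_frobenius x D j"
    then show "acts_as_frobenius x (C \<otimes>\<^bsub>subgroup_generated PGL2 G\<^esub> D) (i + j)"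
      by (simp add: acts_as_frobenius_mult)
  next
    fix C D i assume "acts_as_frobenius x C i" "acts_as_frobenius x D i"
    then show "C = D" by (rule acts_as_frobenius_inj[OF assms(3) deg x])
  qed
  with assms(2) show False by contradiction
qed

end
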